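(* Let $\mathcal{T}=(Q,\Sigma,\delta)$ be a $G$-automaton with $Q\neq\emptyset$. A word $u\in\Sigma^*$ is expandable (with respect to $\mathcal{T}$) if and only if $$\mathrm{Stab}_{\mathcal{T}\sqcup\overline{\mathcal{T}}}(u)\cdot u\,\circ=\{\,(\boldsymbol{q}\cdot u)\circ\ \mid\ \boldsymbol{q}\in\mathrm{Stab}_{\mathcal{T}\sqcup\overline{\mathcal{T}}}(u)\,\}\neq\{1\},$$ where $1$ denotes the identity function on $\Sigma^*$.
   Context: An alphabet is a non-empty finite set; $\Sigma^*$ is the set of finite words over $\Sigma$, including the empty word $\varepsilon$. An automaton is a triple $\mathcal{T}=(Q,\Sigma,\delta)$ with a finite set $Q$ of states, an alphabet $\Sigma$ and $\delta\subseteq Q\times\Sigma\times\Sigma\times Q$; a transition $(q,a,b,p)$ goes from $q$ to $p$, reads $a$ and outputs $b$. It is deterministic (resp. complete) if for all $q\in Q,a\in\Sigma$ there is at most (resp. at least) one transition $(q,a,b,p)\in\delta$. Its inverse is $\overline{\mathcal{T}}=(\overline{Q},\Sigma,\overline{\delta})$, where $\overline{Q}=\{\overline q\mid q\in Q\}$ is a disjoint copy of $Q$ and $\overline\delta=\{(\overline q,b,a,\overline p)\mid(q,a,b,p)\in\delta\}$. A $G$-automaton is an automaton that is complete and deterministic and whose inverse $\overline{\mathcal{T}}$ is deterministic. $\mathcal{T}\sqcup\overline{\mathcal{T}}$ is the disjoint union, with state set $\widetilde Q=Q\sqcup\overline Q$, alphabet $\Sigma$ and transitions $\delta\sqcup\overline\delta$.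 In a deterministic automaton each state $q$ induces a partial length-preserving function $q\circ\colon\Sigma^*\to\Sigma^*$, mapping $u$ to the output of the unique run starting in $q$ with input $u$ (undefined if there is no such run), and $q\cdot u$ denotes the end state of that run. For state sequences, $q_\ell\dots q_1\circ$ is the composition applying $q_1\circ$ first and $q_\ell\circ$ last ($\varepsilon\circ$ is the identity), and the dual action is $\varepsilon\cdot u=\varepsilon$, $\boldsymbol{p}q\cdot u=(\boldsymbol{p}\cdot(q\circ u))(q\cdot u)$ for a state sequence $\boldsymbol p$ and a state $q$. For a $G$-automaton, all functions $\boldsymbol q\circ$ with $\boldsymbol q\in\widetilde Q^*$ are total bijections and $\cdot u$ is total on $\widetilde Q^*$. $\mathrm{Stab}_{\mathcal{T}\sqcup\overline{\mathcal{T}}}(u)=\{\boldsymbol{q}\in\widetilde Q^+\mid\boldsymbol{q}\circ u=u\}$, where $\widetilde Q^+$ is the set of non-empty finite sequences over $\widetilde Q$. The orbit of $u$ is $Q^*\circ u=\{\boldsymbol q\circ u\mid\boldsymbol q\in Q^*\}$. The word $u$ is expandable (with respect to $\mathcal{T}$) if there is $x\in\Sigma^*$ with $|Q^*\circ ux|>|Q^*\circ u|$ (equivalently $|Q^*\circ ux|-|Q^*\circ u|\ge k$ for some $k\ge1$). *)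

theory Defs
  imports Main
begin

record ('q, 'a) automaton =
  states :: "'q set"
  alphabet :: "'a set"
  transitions :: "('q \<times> 'a \<times> 'a \<times> 'q) set"

definition is_automaton :: "('q, 'a) automaton \<Rightarrow> bool" where
  "is_automaton T \<longleftrightarrow>
     finite (states T) \<and> finite (alphabet T) \<and> alphabet T \<noteq> {} \<and>
     transitions T \<subseteq> states T \<times> alphabet T \<times> alphabet T \<times> states T"

abbreviation input_words :: "('q, 'a) automaton \<Rightarrow> 'a list set" where
  "input_words T \<equiv> lists (alphabet T)"

definition deterministic :: "('q, 'a) automaton \<Rightarrow> bool" where
  "deterministic T \<longleftrightarrow>
     (\<forall>q\<in>states T. \<forall>a\<in>alphabet T. \<forall>b p b' p'.
        (q, a, b, p) \<in> transitions T \<longrightarrow> (q, a, b', p') \<in> transitions T \<longrightarrow> b = b' \<and> p = p')"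

definition complete :: "('q, 'a) automaton \<Rightarrow> bool" where
  "complete T \<longleftrightarrow> (\<forall>q\<in>states T. \<forall>a\<in>alphabet T. \<exists>b p. (q, a, b, p) \<in> transitions T)"

text \<open>The inverse is built on the same state type; its states are made disjoint from the original
  ones by the tag \<open>Inr\<close> when the disjoint union is formed.\<close>

definition inverse_automaton :: "('q, 'a) automaton \<Rightarrow> ('q, 'a) automaton" where
  "inverse_automaton T =
     \<lparr>states = states T, alphabet = alphabet T,
      transitions = {(q, b, a, p) | q a b p. (q, a, b, p) \<in> transitions T}\<rparr>"

definition disjoint_union ::
    "('p, 'a) automaton \<Rightarrow> ('q, 'a) automaton \<Rightarrow> ('p + 'q, 'a) automaton" where
  "disjoint_union S T =
     \<lparr>states = states S <+> states T, alphabet = alphabet S \<union> alphabet T,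
      transitions = {(Inl q, a, b, Inl p) | q a b p. (q, a, b, p) \<in> transitions S} \<union>
                    {(Inr q, a, b, Inr p) | q a b p. (q, a, b, p) \<in> transitions T}\<rparr>"

definition with_inverse :: "('q, 'a) automaton \<Rightarrow> ('q + 'q, 'a) automaton" where
  "with_inverse T = disjoint_union T (inverse_automaton T)"

definition G_automaton :: "('q, 'a) automaton \<Rightarrow> bool" where
  "G_automaton T \<longleftrightarrow>
     is_automaton T \<and> complete T \<and> deterministic T \<and> deterministic (inverse_automaton T)"

text \<open>\<open>run T q u v p\<close>: there is a run from \<open>q\<close> to \<open>p\<close> with input \<open>u\<close> and output \<open>v\<close>.\<close>

inductive run :: "('q, 'a) automaton \<Rightarrow> 'q \<Rightarrow> 'a list \<Rightarrow> 'a list \<Rightarrow> 'q \<Rightarrow> bool"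
  for T :: "('q, 'a) automaton" where
  run_Nil: "q \<in> states T \<Longrightarrow> run T q [] [] q"
| run_Cons: "(q, a, b, r) \<in> transitions T \<Longrightarrow> run T r u v p \<Longrightarrow> run T q (a # u) (b # v) p"

text \<open>Partial functions are rendered by \<^typ>\<open>'a option\<close>. In the following two definitions the
  description operator is meaningful for deterministic automata, where a run is determined by its
  initial state and its input.\<close>

definition state_act :: "('q, 'a) automaton \<Rightarrow> 'q \<Rightarrow> 'a list \<Rightarrow> 'a list option" where
  "state_act T q u =
     (if \<exists>v p. run T q u v p then Some (THE v. \<exists>p. run T q u v p) else None)"

definition state_dual :: "('q, 'a) automaton \<Rightarrow> 'q \<Rightarrow> 'a list \<Rightarrow> 'q option" where
  "state_dual T q u =
     (if \<exists>v p. run T q u v p then Some (THE p. \<exists>v. run T q u v p) else None)"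

text \<open>A state sequence \<open>q\<^sub>l \<dots> q\<^sub>1\<close>, in which \<open>q\<^sub>1\<close> acts first, is represented by the list
  \<open>[q\<^sub>1, \<dots>, q\<^sub>l]\<close>: the head of the list acts first. Both actions are undefined on words that are
  not over the alphabet.\<close>

fun seq_act :: "('q, 'a) automaton \<Rightarrow> 'q list \<Rightarrow> 'a list \<Rightarrow> 'a list option" where
  "seq_act T [] u = (if u \<in> input_words T then Some u else None)"
| "seq_act T (q # ps) u = Option.bind (state_act T q u) (seq_act T ps)"

fun seq_dual :: "('q, 'a) automaton \<Rightarrow> 'q list \<Rightarrow> 'a list \<Rightarrow> 'q list option" where
  "seq_dual T [] u = (if u \<in> input_words T then Some [] else None)"
| "seq_dual T (q # ps) u =
     Option.bind (state_dual T q u) (\<lambda>q'.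
     Option.bind (state_act T q u) (\<lambda>v.
     Option.bind (seq_dual T ps v) (\<lambda>ps'. Some (q' # ps'))))"

definition identity_on_words :: "('q, 'a) automaton \<Rightarrow> 'a list \<Rightarrow> 'a list option" where
  "identity_on_words T = Some |` input_words T"

definition Stab :: "('q, 'a) automaton \<Rightarrow> 'a list \<Rightarrow> 'q list set" where
  "Stab T u = {qs. qs \<in> lists (states T) \<and> qs \<noteq> [] \<and> seq_act T qs u = Some u}"

text \<open>For a set \<open>P\<close> of state sequences, the set \<open>P \<cdot> u \<circ>\<close> of partial functions on words.\<close>

definition dual_functions ::
    "('q, 'a) automaton \<Rightarrow> 'q list set \<Rightarrow> 'a list \<Rightarrow> ('a list \<Rightarrow> 'a list option) set" where
  "dual_functions T P u = {seq_act T ps | qs ps. qs \<in> P \<and> seq_dual T qs u = Some ps}"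

definition orbit :: "('q, 'a) automaton \<Rightarrow> 'a list \<Rightarrow> 'a list set" where
  "orbit T u = {v. \<exists>qs\<in>lists (states T). seq_act T qs u = Some v}"

definition expandable :: "('q, 'a) automaton \<Rightarrow> 'a list \<Rightarrow> bool" where
  "expandable T u \<longleftrightarrow> (\<exists>x\<in>input_words T. card (orbit T (u @ x)) > card (orbit T u))"

end

theory Submission
  imports Defs
begin

text \<open>The map \<open>v \<mapsto> take |u| v\<close> sends the orbit of \<open>ux\<close> onto the orbit of \<open>u\<close>, so expandability by
  \<open>x\<close> means that it is not injective. If \<open>g\<close> and \<open>h\<close> send \<open>ux\<close> to two different words with the same
  prefix of length \<open>|u|\<close>, then \<open>h\<close> followed by the inverse of \<open>g\<close> stabilises \<open>u\<close> but moves \<open>ux\<close>, so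
  its dual at \<open>u\<close> moves \<open>x\<close>. Conversely, a stabilising sequence whose dual at \<open>u\<close> moves \<open>x\<close> yields
  two elements of the orbit of \<open>ux\<close> with prefix \<open>u\<close>; here one needs that the orbit under \<open>Q\<^sup>*\<close> is
  also closed under the inverse states, which holds because it is finite.\<close>

section \<open>Complete deterministic automata\<close>

locale total_automaton =
  fixes T :: "('q, 'a) automaton"
  assumes aut: "is_automaton T"
    and compl: "complete T"
    and det: "deterministic T"
begin

lemma transitionD:
  assumes "(q, a, b, p) \<in> transitions T"
  shows "q \<in> states T" "a \<in> alphabet T" "b \<in> alphabet T" "p \<in> states T"
  using assms aut unfolding is_automaton_def by auto

lemma runD:
  assumes "run T q u v p"
  shows "q \<in> states T" "p \<in> states T" "u \<in> input_words T" "v \<in> input_words T"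
    "length v = length u"
  using assms by (induction rule: run.induct) (auto dest: transitionD)

lemma run_unique:
  assumes "run T q u v p" and "run T q u v' p'"
  shows "v = v' \<and> p = p'"
  using assms
proof (induction arbitrary: v' p' rule: run.induct)
  case (run_Nil q)
  then show ?case by (auto elim: run.cases)
next
  case (run_Cons q a b r u v p)
  from run_Cons.prems obtain b' r' v'' where
    *: "(q, a, b', r') \<in> transitions T" "run T r' u v'' p'" "v' = b' # v''"
    by (auto elim: run.cases)
  then have "b = b' \<and> r = r'"
    using run_Cons.hyps(1) det transitionD(1,2)[OF run_Cons.hyps(1)]
    unfolding deterministic_def by blast
  with * run_Cons.IH show ?case by auto
qed

lemma run_total:
  assumes "u \<in> input_words T" and "q \<in> states T"
  shows "\<exists>v p. run T q u v p"
  using assms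
proof (induction u arbitrary: q)
  case Nil
  then show ?case by (auto intro: run_Nil)
next
  case (Cons a u)
  then obtain b r where "(q, a, b, r) \<in> transitions T"
    using compl unfolding complete_def by blast
  with Cons show ?case using transitionD(4) by (blast intro: run_Cons)
qed

lemma run_append:
  assumes "run T q u v r" and "run T r x y p"
  shows "run T q (u @ x) (v @ y) p"
  using assms by (induction rule: run.induct) (auto intro: run.intros)

lemma state_act_run: "run T q u v p \<Longrightarrow> state_act T q u = Some v"
  unfolding state_act_def using run_unique by (auto intro!: the_equality)

lemma state_dual_run: "run T q u v p \<Longrightarrow> state_dual T q u = Some p"
  unfolding state_dual_def using run_unique by (auto intro!: the_equality)

lemma state_act_SomeE:
  assumes "state_act T q u = Some v"
  obtains p where "run T q u v p"
proof -
  obtain v' p where "run T q u v' p"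
    using assms unfolding state_act_def by (auto split: if_splits)
  then show thesis using that state_act_run assms by fastforce
qed

lemma state_run:
  assumes "state_act T q u = Some v" and "state_dual T q u = Some p"
  shows "run T q u v p"
  using assms by (metis state_act_SomeE state_dual_run option.inject)

section \<open>Actions of state sequences on words\<close>

lemma seq_act_words:
  assumes "seq_act T qs u = Some v"
  shows "u \<in> input_words T" "v \<in> input_words T" "length v = length u"
  using assms
  by (induction qs arbitrary: u)
    (auto split: if_splits bind_splits elim!: state_act_SomeE dest: runD)

lemma seq_total:
  assumes "qs \<in> lists (states T)" and "u \<in> input_words T"
  shows "\<exists>v ps. seq_act T qs u = Some v \<and> seq_dual T qs u = Some ps \<and> ps \<in> lists (states T)"
  using assms
proof (induction qs arbitrary: u)
  case Nil
  then show ?case by simp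
next
  case (Cons q qs)
  then obtain v p where r: "run T q u v p" using run_total[of u q] by auto
  moreover have "p \<in> states T" "v \<in> input_words T" using runD[OF r] by blast+
  moreover from this obtain w ps where "seq_act T qs v = Some w" "seq_dual T qs v = Some ps"
    "ps \<in> lists (states T)"
    using Cons by blast
  ultimately show ?case using state_act_run[OF r] state_dual_run[OF r] by simp
qed

lemma seq_act_append:
  "seq_act T (ps @ qs) u = Option.bind (seq_act T ps u) (seq_act T qs)"
proof (induction ps arbitrary: u)
  case Nil
  \<comment> \<open>The empty sequence is undefined outside \<open>input_words T\<close>, so the
    left factor could lose values; by \<open>seq_act_words\<close> the action of \<open>qs\<close>
    is undefined there as well.\<close>
  show ?case using seq_act_words(1)[of qs u] by (cases "seq_act T qs u") auto
next
  case (Cons p ps)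
  then show ?case by (cases "state_act T p u") auto
qed

text \<open>Each state runs through the prefix, stops in its dual state and continues from there on
  the rest. This is the link between the dual action at \<open>u\<close> and the action on longer
  words.\<close>

lemma seq_act_append_word:
  assumes "qs \<in> lists (states T)" and "x \<in> input_words T"
    and "seq_act T qs u = Some v" and "seq_dual T qs u = Some ps"
  shows "seq_act T qs (u @ x) = map_option ((@) v) (seq_act T ps x)"
  using assms
proof (induction qs arbitrary: u x ps)
  case Nil
  then show ?case by (auto split: if_splits)
next
  case (Cons q qs)
  then obtain w p ps' where *: "state_act T q u = Some w" "state_dual T q u = Some p"
      "ps = p # ps'" "seq_act T qs w = Some v" "seq_dual T qs w = Some ps'"
    by (auto split: bind_splits)
  then have r: "run T q u w p" using state_run by blast
  \<comment> \<open>The run on \<open>u\<close> ends in \<open>p\<close>; continuing it on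
    \<open>x\<close> gives the run of \<open>q\<close> on \<open>u @ x\<close>, and the remaining
    states then meet \<open>w @ y\<close>.\<close>
  obtain y p' where r': "run T p x y p'"
    using run_total[OF \<open>x \<in> input_words T\<close> runD(2)[OF r]] by blast
  show ?case
    using Cons.IH[of y w ps'] Cons.prems(1) * runD(4)[OF r']
      state_act_run[OF run_append[OF r r']] state_act_run[OF r']
    by simp
qed

section \<open>Orbits and expandability\<close>

lemma orbit_subset: "orbit T u \<subseteq> {v. set v \<subseteq> alphabet T \<and> length v = length u}"
  using seq_act_words unfolding orbit_def by blast

lemma finite_orbit: "finite (orbit T u)"
proof (rule finite_subset[OF orbit_subset])
  show "finite {v. set v \<subseteq> alphabet T \<and> length v = length u}"
    using aut finite_lists_length_eq unfolding is_automaton_def by blast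
qed

text \<open>Truncation commutes with the action: a state sequence sends \<open>u @ x\<close> to the
  image of \<open>u\<close> followed by a word.\<close>

lemma orbit_append:
  assumes "u \<in> input_words T" and "x \<in> input_words T"
  shows "take (length u) ` orbit T (u @ x) = orbit T u"
proof -
  have *: "\<exists>y. seq_act T qs (u @ x) = Some (v @ y) \<and> length v = length u"
    if qs: "qs \<in> lists (states T)" and v: "seq_act T qs u = Some v" for qs v
  proof -
    obtain ps where ps: "seq_dual T qs u = Some ps" "ps \<in> lists (states T)"
      using seq_total[OF qs assms(1)] by blast
    obtain y where "seq_act T ps x = Some y"
      using seq_total[OF ps(2) assms(2)] by blast
    then show ?thesis
      using seq_act_append_word[OF qs assms(2) v ps(1)] seq_act_words(3)[OF v] by simp
  qed
  show ?thesis
  proof (intro equalityI subsetI)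
    fix v assume "v \<in> take (length u) ` orbit T (u @ x)"
    then obtain qs w where qs: "qs \<in> lists (states T)" "seq_act T qs (u @ x) = Some w"
      "v = take (length u) w" unfolding orbit_def by blast
    obtain v' where v': "seq_act T qs u = Some v'"
      using seq_total[OF qs(1) assms(1)] by blast
    then show "v \<in> orbit T u"
      using *[OF qs(1) v'] qs unfolding orbit_def by auto
  next
    fix v assume "v \<in> orbit T u"
    then obtain qs where qs: "qs \<in> lists (states T)" "seq_act T qs u = Some v"
      unfolding orbit_def by blast
    then obtain y where "seq_act T qs (u @ x) = Some (v @ y)" "length v = length u"
      using * by blast
    then have "v @ y \<in> orbit T (u @ x)" "v = take (length u) (v @ y)"
      using qs(1) unfolding orbit_def by auto
    then show "v \<in> take (length u) ` orbit T (u @ x)" by blast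
  qed
qed

text \<open>By \<open>orbit_append\<close> the orbit of \<open>u\<close> is an image of the finite
  orbit of \<open>u @ x\<close>, and such an image is strictly smaller exactly when two elements are
  identified.\<close>

lemma expandable_iff_not_inj:
  assumes "u \<in> input_words T"
  shows "expandable T u \<longleftrightarrow>
    (\<exists>x\<in>input_words T. \<not> inj_on (take (length u)) (orbit T (u @ x)))"
proof -
  have "card (orbit T u) < card (orbit T (u @ x)) \<longleftrightarrow>
      \<not> inj_on (take (length u)) (orbit T (u @ x))" if "x \<in> input_words T" for x
    using card_image_le[OF finite_orbit, of "take (length u)" "u @ x"]
      inj_on_iff_eq_card[OF finite_orbit, of "take (length u)" "u @ x"]
    unfolding orbit_append[OF assms that] by linarith
  then show ?thesis unfolding expandable_def by blast
qed

end

section \<open>Adjoining the inverse automaton\<close>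

fun inv_state :: "'q + 'q \<Rightarrow> 'q + 'q" where
  "inv_state (Inl q) = Inr q"
| "inv_state (Inr q) = Inl q"

text \<open>Formal inverse as in a group: the order is reversed because the state that acts last has
  to be undone first.\<close>

definition inv_seq :: "('q + 'q) list \<Rightarrow> ('q + 'q) list" where
  "inv_seq qs = rev (map inv_state qs)"

lemma with_inverse_simps:
  "states (with_inverse T) = states T <+> states T"
  "alphabet (with_inverse T) = alphabet T"
  "(Inl q, a, b, r) \<in> transitions (with_inverse T) \<longleftrightarrow>
     (\<exists>p. r = Inl p \<and> (q, a, b, p) \<in> transitions T)"
  "(Inr q, a, b, r) \<in> transitions (with_inverse T) \<longleftrightarrow>
     (\<exists>p. r = Inr p \<and> (q, b, a, p) \<in> transitions T)"
  by (auto simp: with_inverse_def disjoint_union_def inverse_automaton_def)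

lemma inv_state_in: "q \<in> states (with_inverse T) \<Longrightarrow> inv_state q \<in> states (with_inverse T)"
  by (cases q) (auto simp: with_inverse_simps)

lemma inv_state_transition:
  "(q, a, b, p) \<in> transitions (with_inverse T) \<Longrightarrow>
   (inv_state q, b, a, inv_state p) \<in> transitions (with_inverse T)"
  by (cases q) (auto simp: with_inverse_simps)

lemma run_inv_state:
  "run (with_inverse T) q u v p \<Longrightarrow> run (with_inverse T) (inv_state q) v u (inv_state p)"
  by (induction rule: run.induct) (auto intro: run.intros inv_state_in inv_state_transition)

lemma run_Inl: "run T q u v p \<Longrightarrow> run (with_inverse T) (Inl q) u v (Inl p)"
  by (induction rule: run.induct) (auto intro!: run.intros simp: with_inverse_simps)

lemma inv_seq_in:
  "qs \<in> lists (states (with_inverse T)) \<Longrightarrow> inv_seq qs \<in> lists (states (with_inverse T))"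
  by (simp add: inv_seq_def in_lists_conv_set inv_state_in)

locale G_aut =
  fixes T :: "('q, 'a) automaton"
  assumes G: "G_automaton T"
begin

sublocale T: total_automaton T
  using G unfolding G_automaton_def by unfold_locales auto

abbreviation M :: "('q + 'q, 'a) automaton" where "M \<equiv> with_inverse T"

text \<open>At each state the map from inputs to outputs is injective, since the inverse is deterministic,
  hence surjective, since the alphabet is finite.\<close>

lemma complete_with_inverse: "complete M"
proof -
  have out: "\<exists>a p. (q, a, b, p) \<in> transitions T" if q: "q \<in> states T" and b: "b \<in> alphabet T" for q b
  proof -
    have "\<forall>a\<in>alphabet T. \<exists>b. \<exists>p. (q, a, b, p) \<in> transitions T"
      using T.compl q unfolding complete_def by blast
    then obtain f where f: "\<And>a. a \<in> alphabet T \<Longrightarrow> \<exists>p. (q, a, f a, p) \<in> transitions T"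
      by metis
    have "f ` alphabet T \<subseteq> alphabet T" using f T.transitionD(3) by blast
    moreover have "inj_on f (alphabet T)"
    proof (rule inj_onI)
      fix a a' assume "a \<in> alphabet T" "a' \<in> alphabet T" "f a = f a'"
      then obtain p p' where *: "(q, a, f a, p) \<in> transitions T" "(q, a', f a, p') \<in> transitions T"
        using f by metis
      have "q \<in> states (inverse_automaton T)" "f a \<in> alphabet (inverse_automaton T)"
        using T.transitionD[OF *(1)] by (auto simp: inverse_automaton_def)
      moreover have "(q, f a, a, p) \<in> transitions (inverse_automaton T)"
        "(q, f a, a', p') \<in> transitions (inverse_automaton T)"
        using * by (auto simp: inverse_automaton_def)
      ultimately show "a = a'"
        using G unfolding G_automaton_def deterministic_def by blast
    qed
    ultimately have "f ` alphabet T = alphabet T"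
      using T.aut endo_inj_surj unfolding is_automaton_def by blast
    then obtain a where "a \<in> alphabet T" "b = f a" using b by (metis imageE)
    then show ?thesis using f by blast
  qed
  have "\<exists>b p. (q, a, b, p) \<in> transitions M" if "q \<in> states M" "a \<in> alphabet M" for q a
  proof (cases q)
    case (Inl q')
    then have "q' \<in> states T" "a \<in> alphabet T" using that by (auto simp: with_inverse_simps)
    then obtain b p where "(q', a, b, p) \<in> transitions T"
      using T.compl unfolding complete_def by blast
    then show ?thesis unfolding Inl with_inverse_simps by blast
  next
    case (Inr q')
    then have "q' \<in> states T" "a \<in> alphabet T" using that by (auto simp: with_inverse_simps)
    then obtain b p where "(q', b, a, p) \<in> transitions T" using out by blast
    then show ?thesis unfolding Inr with_inverse_simps by blast
  qed
  then show ?thesis unfolding complete_def by blast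
qed

lemma deterministic_with_inverse: "deterministic M"
proof -
  have "b = b' \<and> p = p'"
    if "q \<in> states M" "a \<in> alphabet M" "(q, a, b, p) \<in> transitions M"
      "(q, a, b', p') \<in> transitions M" for q a b p b' p'
  proof (cases q)
    case (Inl q')
    then show ?thesis
      using that T.det by (auto simp: with_inverse_simps deterministic_def)
  next
    case (Inr q')
    have "deterministic (inverse_automaton T)" using G unfolding G_automaton_def by blast
    then show ?thesis
      using that Inr by (auto simp: with_inverse_simps deterministic_def inverse_automaton_def)
  qed
  then show ?thesis unfolding deterministic_def by blast
qed

lemma is_automaton_with_inverse: "is_automaton M"
  using T.aut
  by (auto simp: is_automaton_def with_inverse_def disjoint_union_def inverse_automaton_def)

sublocale M: total_automaton M
  using is_automaton_with_inverse complete_with_inverse deterministic_with_inverse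
  by unfold_locales

section \<open>Transfer to the union with the inverse, and inverses of sequences\<close>

lemma state_act_Inl: "state_act T q u = Some v \<Longrightarrow> state_act M (Inl q) u = Some v"
  by (metis T.state_act_SomeE run_Inl M.state_act_run)

lemma seq_act_map_Inl: "seq_act T qs u = Some v \<Longrightarrow> seq_act M (map Inl qs) u = Some v"
proof (induction qs arbitrary: u)
  case Nil
  then show ?case by (simp add: with_inverse_simps)
next
  case (Cons q qs)
  then show ?case by (auto split: bind_splits dest: state_act_Inl)
qed

lemma state_act_inv:
  "state_act M q u = Some v \<Longrightarrow> state_act M (inv_state q) v = Some u"
  by (metis M.state_act_SomeE run_inv_state M.state_act_run)

lemma seq_act_inv:
  assumes "seq_act M qs u = Some v"
  shows "seq_act M (inv_seq qs) v = Some u"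
  using assms
proof (induction qs arbitrary: u)
  case Nil
  then show ?case by (auto simp: inv_seq_def split: if_splits)
next
  case (Cons q qs)
  then obtain w where w: "state_act M q u = Some w" "seq_act M qs w = Some v"
    by (auto split: bind_splits)
  have "u \<in> input_words M" by (rule M.seq_act_words(1)[OF Cons.prems])
  then show ?case
    using Cons.IH[OF w(2)] state_act_inv[OF w(1)]
    by (simp add: inv_seq_def M.seq_act_append)
qed

section \<open>Closure of orbits under inverse states\<close>

lemma orbit_state_act:
  assumes "v \<in> orbit T w" "q \<in> states T" "state_act T q v = Some v'"
  shows "v' \<in> orbit T w"
proof -
  obtain qs where qs: "qs \<in> lists (states T)" "seq_act T qs w = Some v"
    using assms(1) unfolding orbit_def by blast
  obtain p where "run T q v v' p" using assms(3) T.state_act_SomeE by blast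
  then have "seq_act T (qs @ [q]) w = Some v'"
    using qs(2) assms(3) T.runD(4) by (simp add: T.seq_act_append)
  moreover have "qs @ [q] \<in> lists (states T)" using qs(1) assms(2) by simp
  ultimately show ?thesis unfolding orbit_def by blast
qed

text \<open>A state \<open>p\<close> maps the orbit into itself, injectively because
  \<open>Inr p\<close> undoes it. On a finite set this is a permutation, so \<open>v\<close> is the
  image of some orbit element \<open>y\<close>, and \<open>Inr p\<close> sends \<open>v\<close> back
  to \<open>y\<close>.\<close>

lemma orbit_state_act_with_inverse:
  assumes v: "v \<in> orbit T w" and q: "q \<in> states M" and v': "state_act M q v = Some v'"
  shows "v' \<in> orbit T w"
proof -
  define f where "f q v = the (state_act T q v)" for q v
  have f: "state_act T q v = Some (f q v)" if "v \<in> orbit T w" "q \<in> states T" for q v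
  proof -
    have "v \<in> input_words T" using that(1) T.orbit_subset by blast
    then show ?thesis
      using T.run_total[OF _ that(2)] T.state_act_run unfolding f_def by (metis option.sel)
  qed
  show ?thesis
  proof (cases q)
    case (Inl p)
    then have "p \<in> states T" using q by (auto simp: with_inverse_simps)
    with f[OF v] orbit_state_act[OF v] state_act_Inl v' Inl show ?thesis
      by (metis option.inject)
  next
    case (Inr p)
    then have p: "p \<in> states T" using q by (auto simp: with_inverse_simps)
    have undone: "state_act M q (f p y) = Some y" if "y \<in> orbit T w" for y
      using state_act_inv[OF state_act_Inl[OF f[OF that p]]] Inr by simp
    have "f p ` orbit T w \<subseteq> orbit T w"
      using orbit_state_act[OF _ p f[OF _ p]] by (rule image_subsetI)
    moreover have "inj_on (f p) (orbit T w)"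
      using undone by (metis inj_onI option.inject)
    ultimately have "f p ` orbit T w = orbit T w"
      using endo_inj_surj T.finite_orbit by blast
    then obtain y where "y \<in> orbit T w" "v = f p y" using v by (metis imageE)
    then show ?thesis using undone v' by simp
  qed
qed

lemma orbit_seq_act_with_inverse:
  assumes "v \<in> orbit T w" "qs \<in> lists (states M)" "seq_act M qs v = Some v'"
  shows "v' \<in> orbit T w"
  using assms
  by (induction qs arbitrary: v)
    (auto split: if_splits bind_splits dest: orbit_state_act_with_inverse)

section \<open>Both sides of the equivalence in terms of stabilisers\<close>

text \<open>This eliminates the dual action: the dual of a stabilising sequence at \<open>u\<close>
  is the identity exactly when the sequence fixes every extension of \<open>u\<close>.\<close>

lemma dual_functions_eq_iff:
  assumes "states T \<noteq> {}" and "u \<in> input_words T"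
  shows "dual_functions M (Stab M u) u = {identity_on_words T} \<longleftrightarrow>
    (\<forall>qs\<in>Stab M u. \<forall>x\<in>input_words T. seq_act M qs (u @ x) = Some (u @ x))"
    (is "?D = _ \<longleftrightarrow> ?R")
proof -
  have u: "u \<in> input_words M" using assms(2) by (simp add: with_inverse_simps)
  have dual: "\<exists>ps. seq_dual M qs u = Some ps" if "qs \<in> Stab M u" for qs
    using that M.seq_total[of qs u] u by (auto simp: Stab_def)
  obtain q where q: "q \<in> states T" using assms(1) by blast
  obtain v p where r: "run M (Inl q) u v p"
    using M.run_total[OF u, of "Inl q"] q unfolding with_inverse_simps by blast
  \<comment> \<open>A state followed by its inverse is a non-empty stabilising sequence. Hence the
    set of dual functions is not empty, which equality with a singleton requires.\<close>
  have "seq_act M [Inl q, Inr q] u = Some u"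
    using M.state_act_run[OF r] M.state_act_run[OF run_inv_state[OF r]] u by simp
  then have "[Inl q, Inr q] \<in> Stab M u"
    using q by (auto simp: Stab_def with_inverse_simps)
  then have ne: "?D \<noteq> {}"
    using dual unfolding dual_functions_def by blast
  have key: "seq_act M ps = identity_on_words T \<longleftrightarrow>
      (\<forall>x\<in>input_words T. seq_act M qs (u @ x) = Some (u @ x))"
    if "qs \<in> Stab M u" "seq_dual M qs u = Some ps" for qs ps
  proof -
    have qs: "qs \<in> lists (states M)" "seq_act M qs u = Some u"
      using that(1) by (auto simp: Stab_def)
    \<comment> \<open>Off the alphabet both partial functions are undefined, so they need to be
      compared on \<open>input_words T\<close> only.\<close>
    have "seq_act M ps x = None" if "x \<notin> input_words T" for x
      using M.seq_act_words(1)[of ps x] that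
      by (cases "seq_act M ps x") (auto simp: with_inverse_simps)
    then have "seq_act M ps = identity_on_words T \<longleftrightarrow>
        (\<forall>x\<in>input_words T. seq_act M ps x = Some x)"
      by (auto simp: identity_on_words_def restrict_map_def fun_eq_iff)
    \<comment> \<open>Since \<open>qs\<close> fixes \<open>u\<close>, it sends \<open>u @ x\<close>
      to \<open>u\<close> followed by the image of \<open>x\<close> under \<open>ps\<close>; the
      common prefix cancels.\<close>
    also have "\<dots> \<longleftrightarrow> (\<forall>x\<in>input_words T. seq_act M qs (u @ x) = Some (u @ x))"
      using M.seq_act_append_word[OF qs(1) _ qs(2) that(2)]
      by (intro ball_cong refl) (simp add: with_inverse_simps)
    finally show ?thesis .
  qed
  have "?D = {identity_on_words T} \<longleftrightarrow> (\<forall>f\<in>?D. f = identity_on_words T)"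
    using ne subset_singleton_iff[of ?D "identity_on_words T"] by (auto simp: subset_iff)
  also have "\<dots> \<longleftrightarrow> (\<forall>qs\<in>Stab M u. \<forall>ps. seq_dual M qs u = Some ps \<longrightarrow>
      seq_act M ps = identity_on_words T)"
    unfolding dual_functions_def by blast
  also have "\<dots> \<longleftrightarrow> ?R"
    using key dual by meson
  finally show ?thesis .
qed

lemma expandable_iff:
  assumes "u \<in> input_words T"
  shows "expandable T u \<longleftrightarrow>
    (\<exists>qs\<in>Stab M u. \<exists>x\<in>input_words T. seq_act M qs (u @ x) \<noteq> Some (u @ x))"
proof
  assume "expandable T u"
  then obtain x y y' where x: "x \<in> input_words T"
    and y: "y \<in> orbit T (u @ x)" "y' \<in> orbit T (u @ x)"
    and ne: "y \<noteq> y'" and take: "take (length u) y = take (length u) y'"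
    using T.expandable_iff_not_inj[OF assms] unfolding inj_on_def by blast
  \<comment> \<open>A sequence over the original states that reaches \<open>z\<close> is moved into
    the union by \<open>Inl\<close>; its value at \<open>u\<close> is the corresponding prefix of
    \<open>z\<close>.\<close>
  have *: "\<exists>gs\<in>lists (states M). seq_act M gs (u @ x) = Some z \<and>
      seq_act M gs u = Some (take (length u) z)" if "z \<in> orbit T (u @ x)" for z
  proof -
    obtain hs where hs: "hs \<in> lists (states T)" "seq_act T hs (u @ x) = Some z"
      using \<open>z \<in> orbit T (u @ x)\<close> unfolding orbit_def by blast
    define gs :: "('q + 'q) list" where "gs = map Inl hs"
    have gs: "gs \<in> lists (states M)" using hs(1) by (auto simp: gs_def with_inverse_simps)
    have act: "seq_act M gs (u @ x) = Some z"
      unfolding gs_def using hs(2) by (rule seq_act_map_Inl)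
    have u: "u \<in> input_words M" and xM: "x \<in> input_words M"
      using assms x by (simp_all add: with_inverse_simps)
    obtain v ps where v: "seq_act M gs u = Some v" "seq_dual M gs u = Some ps"
      using M.seq_total[OF gs u] by blast
    then have "take (length u) z = v"
      using M.seq_act_append_word[OF gs xM v] act M.seq_act_words(3)[OF v(1)]
      by (cases "seq_act M ps x") auto
    then show ?thesis using gs act v(1) by blast
  qed
  obtain gs where gs: "gs \<in> lists (states M)" "seq_act M gs (u @ x) = Some y"
      "seq_act M gs u = Some (take (length u) y)" using *[OF y(1)] by blast
  obtain hs where hs: "hs \<in> lists (states M)" "seq_act M hs (u @ x) = Some y'"
      "seq_act M hs u = Some (take (length u) y)" using *[OF y(2)] take by auto
  \<comment> \<open>Both \<open>gs\<close> and \<open>hs\<close> send \<open>u\<close> to the same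
    prefix, so \<open>hs\<close> followed by the inverse of \<open>gs\<close> fixes
    \<open>u\<close>.\<close>
  have act: "seq_act M (hs @ inv_seq gs) (u @ x) = seq_act M (inv_seq gs) y'"
    using hs(2) by (simp add: M.seq_act_append)
  have moved: "seq_act M (hs @ inv_seq gs) (u @ x) \<noteq> Some (u @ x)"
  proof
    assume "seq_act M (hs @ inv_seq gs) (u @ x) = Some (u @ x)"
    \<comment> \<open>If \<open>u @ x\<close> were fixed, the inverse of \<open>gs\<close> would
      send \<open>y'\<close> to \<open>u @ x\<close>. Inverting once more gives \<open>y'\<close> as
      the image of \<open>u @ x\<close>, whereas inverting \<open>gs\<close> twice gives
      \<open>y\<close>.\<close>
    then have "seq_act M (inv_seq (inv_seq gs)) (u @ x) = Some y'"
      using act seq_act_inv by metis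
    moreover have "seq_act M (inv_seq (inv_seq gs)) (u @ x) = Some y"
      using seq_act_inv[OF seq_act_inv[OF gs(2)]] .
    ultimately show False using ne by simp
  qed
  moreover have "hs @ inv_seq gs \<in> Stab M u"
  proof -
    have "seq_act M (hs @ inv_seq gs) u = Some u"
      using hs(3) seq_act_inv[OF gs(3)] by (simp add: M.seq_act_append)
    \<comment> \<open>\<open>Stab\<close> admits only non-empty sequences; the empty one would fix
      \<open>u @ x\<close>, against \<open>moved\<close>.\<close>
    moreover have "hs @ inv_seq gs \<noteq> []"
    proof
      assume "hs @ inv_seq gs = []"
      moreover have "u @ x \<in> input_words M" using assms x by (simp add: with_inverse_simps)
      ultimately show False using moved by (metis seq_act.simps(1))
    qed
    ultimately show ?thesis
      using hs(1) inv_seq_in[OF gs(1)] by (simp add: Stab_def)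
  qed
  ultimately show "\<exists>qs\<in>Stab M u. \<exists>x\<in>input_words T. seq_act M qs (u @ x) \<noteq> Some (u @ x)"
    using x by blast
next
  assume "\<exists>qs\<in>Stab M u. \<exists>x\<in>input_words T. seq_act M qs (u @ x) \<noteq> Some (u @ x)"
  then obtain qs x where qs: "qs \<in> lists (states M)" "seq_act M qs u = Some u"
    and x: "x \<in> input_words T" and ne: "seq_act M qs (u @ x) \<noteq> Some (u @ x)"
    unfolding Stab_def by blast
  have u: "u \<in> input_words M" and xM: "x \<in> input_words M"
    using assms x by (simp_all add: with_inverse_simps)
  obtain ps where ps: "seq_dual M qs u = Some ps" "ps \<in> lists (states M)"
    using M.seq_total[OF qs(1) u] by blast
  obtain y where "seq_act M ps x = Some y" using M.seq_total[OF ps(2) xM] by blast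
  then have act: "seq_act M qs (u @ x) = Some (u @ y)"
    using M.seq_act_append_word[OF qs(1) xM qs(2) ps(1)] by simp
  have "seq_act T [] (u @ x) = Some (u @ x)" using assms x by simp
  then have mem: "u @ x \<in> orbit T (u @ x)" unfolding orbit_def by blast
  then have "u @ y \<in> orbit T (u @ x)"
    using orbit_seq_act_with_inverse qs(1) act by blast
  \<comment> \<open>The words \<open>u @ x\<close> and \<open>u @ y\<close> are distinct elements of
    the orbit that both truncate to \<open>u\<close>.\<close>
  with mem ne act have "\<not> inj_on (take (length u)) (orbit T (u @ x))"
    unfolding inj_on_def by force
  then show "expandable T u" using T.expandable_iff_not_inj[OF assms] x by blast
qed

end

theorem proposition4p2:
  fixes T :: "('q, 'a) automaton" and u :: "'a list"
  assumes "G_automaton T" and "states T \<noteq> {}" and "u \<in> input_words T"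
  shows "expandable T u \<longleftrightarrow>
    dual_functions (with_inverse T) (Stab (with_inverse T) u) u \<noteq> {identity_on_words T}"
proof -
  interpret G_aut T using assms(1) by unfold_locales
  show ?thesis
    using expandable_iff[OF assms(3)] dual_functions_eq_iff[OF assms(2,3)] by blast
qed

end
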